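(* Let $f(x)=\dfrac{1+x}{\cos x}=\sum_{k\ge0}a_kx^k/k!$, so that $a_{2k}=E_{2k}$ and $a_{2k+1}=(2k+1)E_{2k}$, where the $E_{2k}$ are the secant numbers. Then for all $n\ge 1$, $$\ddot H_n(f)=\det(a_{2i+j})_{0\le i,j\le n-1}=2^{\binom n2}\,\bigl((n-1)!!\bigr)^2\prod_{k=1}^{n-2}(k!!)^6.$$
   Context: The secant numbers are defined by $1/\cos x=\sum_{k\ge0}E_{2k}x^{2k}/(2k)!$. Conventions: $m!!=m(m-2)(m-4)\cdots$ down to $1$ or $2$, with $0!!=(-1)!!=1$; empty products equal $1$. *)

theory Defs
  imports
    "HOL-Computational_Algebra.Formal_Power_Series"
    "Jordan_Normal_Form.Determinant"
begin

text \<open>\<open>egf_coeff F k\<close> is the \<open>a\<^sub>k\<close> in \<open>F = (\<Sum>k. a\<^sub>k x^k / k!)\<close>.\<close>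

definition egf_coeff :: "real fps \<Rightarrow> nat \<Rightarrow> real" where
  "egf_coeff F k = fact k * fps_nth F k"

text \<open>
  Indexed by the exponent: the number usually written \<open>E\<^sub>2\<^sub>k\<close> is \<open>secant_number (2 * k)\<close>,
  and the value at an odd index is an odd coefficient of the secant series.
\<close>

definition secant_number :: "nat \<Rightarrow> real" where
  "secant_number m = egf_coeff (1 / fps_cos 1) m"

definition ddot_hankel :: "nat \<Rightarrow> real fps \<Rightarrow> real" where
  "ddot_hankel n F = det (mat n n (\<lambda>(i, j). egf_coeff F (2 * i + j)))"

text \<open>On naturals the double factorial of \<open>-1\<close> does not arise.\<close>

fun double_fact :: "nat \<Rightarrow> nat" where
  "double_fact 0 = 1"
| "double_fact (Suc 0) = 1"
| "double_fact (Suc (Suc m)) = Suc (Suc m) * double_fact m"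

end

theory Submission
  imports Defs
begin

text \<open>
  Let \<open>T p = v ((v\<^sup>3 - v) p')' + v\<^sup>2 p\<close> on polynomials in \<open>v\<close>, so that
  \<open>T v\<^sup>k = (k + 1)\<^sup>2 v\<^bsup>k+2\<^esup> - k\<^sup>2 v\<^sup>k\<close>. The series \<open>U\<^sub>k = sec\<^sup>k x \<integral> cos\<^bsup>k-1\<^esup> x dx\<close> satisfy
  \<open>U\<^sub>k'' = (k + 1)\<^sup>2 U\<^bsub>k+2\<^esub> - k\<^sup>2 U\<^sub>k\<close>, hence \<open>(T\<^sup>i v\<^sup>k)(1)\<close> is the derivative of \<open>U\<^sub>k\<close>
  of order \<open>2i + 1\<close> at \<open>0\<close>. As \<open>U\<^sub>0' = sec x\<close> and \<open>U\<^sub>1 = x sec x\<close>, this gives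
  \<open>a\<^bsub>2i+j\<^esub> = (T\<^sup>i c\<^sub>j)(1)\<close> with \<open>c\<^bsub>2m\<^esub> = T\<^sup>m 1\<close> and \<open>c\<^bsub>2m+1\<^esub> = T\<^sup>m v\<close>.
  The polynomial \<open>c\<^sub>j\<close> has degree \<open>j\<close> and leading coefficient \<open>((j - 1)!!)\<^sup>2\<close>. Since
  \<open>v\<^sup>3 - v\<close> vanishes at \<open>1\<close>, \<open>T\<close> lowers the order of vanishing at \<open>1\<close> by at most one, and
  \<open>(T\<^sup>i (v - 1)\<^sup>r)(1)\<close> is \<open>0\<close> for \<open>r > i\<close> and \<open>2\<^sup>i i!\<^sup>2\<close> for \<open>r = i\<close>. Expanding \<open>c\<^sub>j\<close> in powers
  of \<open>v - 1\<close> therefore factors the matrix into a lower and an upper triangular one.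
\<close>

section \<open>The operator \<open>T\<close> on polynomials\<close>

definition sec_op :: "real poly \<Rightarrow> real poly" where
  "sec_op p = [:0, 1:] * pderiv ([:0, -1, 0, 1:] * pderiv p) + [:0, 0, 1:] * p"

lemma coeff_sec_op:
  "coeff (sec_op p) n =
    (if n < 2 then 0 else (real n - 1)^2 * coeff p (n - 2)) - (real n)^2 * coeff p n"
proof -
  consider "n = 0" | "n = 1" | m where "n = Suc (Suc m)"
    by (metis One_nat_def not0_implies_Suc)
  then show ?thesis
    by cases (auto simp: sec_op_def coeff_pderiv coeff_pCons power2_eq_square algebra_simps
        split: nat.splits)
qed

lemma sec_op_add: "sec_op (p + q) = sec_op p + sec_op q"
  by (rule poly_eqI) (simp add: coeff_sec_op algebra_simps)

lemma sec_op_smult: "sec_op (smult c p) = smult c (sec_op p)"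
  by (rule poly_eqI) (simp add: coeff_sec_op algebra_simps)

lemma sec_op_0: "sec_op 0 = 0"
  by (simp add: sec_op_def)

lemma sec_op_pow_add: "(sec_op ^^ i) (p + q) = (sec_op ^^ i) p + (sec_op ^^ i) q"
  by (induction i) (simp_all add: sec_op_add)

lemma sec_op_pow_smult: "(sec_op ^^ i) (smult c p) = smult c ((sec_op ^^ i) p)"
  by (induction i) (simp_all add: sec_op_smult)

lemma sec_op_pow_sum:
  "(sec_op ^^ i) (sum g A) = (\<Sum>x\<in>A. (sec_op ^^ i) (g x))"
proof -
  have "(sec_op ^^ i) 0 = 0"
    by (induction i) (simp_all add: sec_op_0)
  then show ?thesis
    by (induction A rule: infinite_finite_induct) (simp_all add: sec_op_pow_add)
qed

lemma sec_op_monom: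
  "sec_op (monom 1 k) = smult ((real k + 1)^2) (monom 1 (k + 2)) + smult (- ((real k)^2)) (monom 1 k)"
  by (rule poly_eqI) (auto simp: coeff_sec_op)

section \<open>Order of vanishing at 1\<close>

text \<open>The factor \<open>v - 1\<close> of \<open>v^3 - v\<close> restores the order lost to the
  inner derivative, so only the outer one costs an order. Each derivative yields a factor
  \<open>r + 1\<close>; the cofactor \<open>v^2 + v\<close> yields the 2.\<close>

lemma sec_op_shifted_power:
  "\<exists>q'. sec_op ([:-1, 1:] ^ Suc r * q) = [:-1, 1:] ^ r * q' \<and> poly q' 1 = 2 * (real (Suc r))^2 * poly q 1"
proof -
  define w where "w = [:-1, 1 :: real:]"
  have pd: "pderiv (w ^ Suc r * h) = w ^ r * (smult (real (Suc r)) h + w * pderiv h)" for h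
  proof -
    have "pderiv w = 1"
      by (simp add: w_def pderiv_pCons)
    then show ?thesis
      by (simp only: pderiv_mult pderiv_power_Suc) (simp add: algebra_simps del: of_nat_Suc)
  qed
  define h where "h = [:0, 1, 1:] * (smult (real (Suc r)) q + w * pderiv q)"
  have cubic: "[:0, -1, 0, 1:] = w * [:0, 1, 1:]"
    by (simp add: w_def)
  have inner: "[:0, -1, 0, 1:] * pderiv (w ^ Suc r * q) = w ^ Suc r * h"
    unfolding cubic pd h_def by (simp only: power_Suc mult_ac)
  have "sec_op (w ^ Suc r * q) =
      w ^ r * ([:0, 1:] * (smult (real (Suc r)) h + w * pderiv h) + [:0, 0, 1:] * w * q)"
    unfolding sec_op_def inner unfolding pd by (simp only: power_Suc distrib_left mult.assoc mult.left_commute)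
  moreover have "poly ([:0, 1:] * (smult (real (Suc r)) h + w * pderiv h) + [:0, 0, 1:] * w * q) 1 =
      2 * (real (Suc r))^2 * poly q 1"
    by (simp add: h_def w_def power2_eq_square)
  ultimately show ?thesis
    unfolding w_def by blast
qed

text \<open>The cofactor \<open>q\<close> is arbitrary because each application of
  \<open>sec_op\<close> changes it; only its value at 1 is tracked.\<close>

lemma poly_sec_op_pow_shifted_power_diag:
  "poly ((sec_op ^^ i) ([:-1, 1:] ^ i * q)) 1 = 2 ^ i * (fact i)^2 * poly q 1"
proof (induction i arbitrary: q)
  case (Suc i)
  obtain q' where q': "sec_op ([:-1, 1:] ^ Suc i * q) = [:-1, 1:] ^ i * q'"
    "poly q' 1 = 2 * (real (Suc i))^2 * poly q 1"
    using sec_op_shifted_power by blast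
  have "poly ((sec_op ^^ Suc i) ([:-1, 1:] ^ Suc i * q)) 1 = poly ((sec_op ^^ i) ([:-1, 1:] ^ i * q')) 1"
    by (simp only: funpow_Suc_right o_apply q')
  also have "\<dots> = 2 ^ Suc i * (fact (Suc i))^2 * poly q 1"
    unfolding Suc.IH q' by (simp add: power2_eq_square algebra_simps)
  finally show ?case .
qed simp

lemma poly_sec_op_pow_shifted_power_eq_0:
  assumes "i < r"
  shows "poly ((sec_op ^^ i) ([:-1, 1:] ^ r)) 1 = 0"
proof -
  \<comment> \<open>The surplus \<open>(v - 1)^(r - i)\<close> serves as the cofactor, and it
    vanishes at 1.\<close>
  have "[:-1, 1 :: real:] ^ r = [:-1, 1:] ^ i * [:-1, 1:] ^ (r - i)"
    using assms by (simp flip: power_add)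
  then show ?thesis
    using assms by (simp only: poly_sec_op_pow_shifted_power_diag) simp
qed

lemma poly_eq_sum_shifted_powers:
  fixes p :: "real poly"
  assumes "degree p < n"
  shows "p = (\<Sum>r<n. smult (coeff (p \<circ>\<^sub>p [:1, 1:]) r) ([:-1, 1:] ^ r))"
proof -
  let ?q = "p \<circ>\<^sub>p [:1, 1:]"
  have q: "?q = (\<Sum>r<n. monom (coeff ?q r) r)"
  proof (rule poly_eqI)
    fix k
    show "coeff ?q k = coeff (\<Sum>r<n. monom (coeff ?q r) r) k"
      using assms by (auto simp: coeff_sum degree_pcompose intro!: coeff_eq_0)
  qed
  have "poly p x = poly (\<Sum>r<n. smult (coeff ?q r) ([:-1, 1:] ^ r)) x" for x
  proof -
    have "poly p x = poly ?q (x - 1)"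
      by (simp add: poly_pcompose)
    also have "\<dots> = (\<Sum>r<n. coeff ?q r * (x - 1) ^ r)"
      by (subst q) (simp add: poly_sum poly_monom)
    finally show ?thesis
      by (simp add: poly_sum)
  qed
  then show ?thesis
    using poly_eq_poly_eq_iff by blast
qed

section \<open>The polynomials \<open>c\<^sub>j\<close> and the triangular factorization\<close>

definition sec_orbit :: "nat \<Rightarrow> real poly" where
  "sec_orbit j = (sec_op ^^ (j div 2)) (monom 1 (j mod 2))"

lemma sec_orbit_Suc_Suc: "sec_orbit (Suc (Suc j)) = sec_op (sec_orbit j)"
  by (simp add: sec_orbit_def)

text \<open>At \<open>j = 0\<close> truncated subtraction puts \<open>0!! = 1\<close> in place of
  \<open>(-1)!! = 1\<close>.\<close>

lemma double_fact_step: "double_fact (Suc j) = Suc j * double_fact (j - 1)"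
  by (cases j) auto

lemma sec_orbit_degree_coeff:
  "degree (sec_orbit j) \<le> j \<and> coeff (sec_orbit j) j = (real (double_fact (j - 1)))^2"
proof (induction j rule: double_fact.induct)
  case 1
  then show ?case by (simp add: sec_orbit_def)
next
  case 2
  then show ?case by (simp add: sec_orbit_def degree_monom_eq)
next
  case (3 j)
  have "coeff (sec_orbit j) k = 0" if "k > j" for k
    using 3 that by (intro coeff_eq_0) auto
  then have "degree (sec_orbit (Suc (Suc j))) \<le> Suc (Suc j)"
    by (intro degree_le) (auto simp: sec_orbit_Suc_Suc coeff_sec_op)
  moreover have "coeff (sec_orbit (Suc (Suc j))) (Suc (Suc j)) = (real (Suc j))^2 * coeff (sec_orbit j) j"
    using 3 by (simp add: sec_orbit_Suc_Suc coeff_sec_op coeff_eq_0 le_imp_less_Suc)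
  ultimately show ?case
    using 3 by (simp add: double_fact_step power_mult_distrib del: double_fact.simps mult_Suc of_nat_Suc)
qed

lemma det_sec_op:
  "det (mat n n (\<lambda>(i, j). poly ((sec_op ^^ i) (sec_orbit j)) 1)) =
    (\<Prod>i<n. 2 ^ i * (fact i)^2 * (real (double_fact (i - 1)))^2)"
proof -
  define C where "C r j = coeff (sec_orbit j \<circ>\<^sub>p [:1, 1:]) r" for r j
  define L where "L = mat n n (\<lambda>(i, r). poly ((sec_op ^^ i) ([:-1, 1:] ^ r)) 1)"
  define R where "R = mat n n (\<lambda>(r, j). C r j)"
  have deg: "degree (sec_orbit j) \<le> j" for j
    using sec_orbit_degree_coeff by blast
  have C_upper: "C r j = 0" if "j < r" for r j
    unfolding C_def using deg[of j] that by (intro coeff_eq_0) (simp add: degree_pcompose)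
  \<comment> \<open>Translation by 1 preserves the leading coefficient. If the degree were below
    \<open>j\<close>, both coefficients would be 0.\<close>
  have C_diag: "C j j = (real (double_fact (j - 1)))^2" for j
  proof (cases "degree (sec_orbit j) = j")
    case True
    then have "C j j = lead_coeff (sec_orbit j \<circ>\<^sub>p [:1, 1:])"
      by (simp add: C_def degree_pcompose)
    also have "\<dots> = lead_coeff (sec_orbit j)"
      by (subst lead_coeff_comp) simp_all
    finally show ?thesis
      using True sec_orbit_degree_coeff[of j] by simp
  next
    case False
    then have lt: "degree (sec_orbit j) < j"
      using deg[of j] by simp
    then have "C j j = 0"
      unfolding C_def by (intro coeff_eq_0) (simp add: degree_pcompose)
    moreover have "coeff (sec_orbit j) j = 0"
      using lt by (rule coeff_eq_0)
    ultimately show ?thesis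
      using sec_orbit_degree_coeff[of j] by simp
  qed
  have "mat n n (\<lambda>(i, j). poly ((sec_op ^^ i) (sec_orbit j)) 1) = L * R"
  proof (rule eq_matI)
    fix i j assume "i < dim_row (L * R)" "j < dim_col (L * R)"
    then have ij: "i < n" "j < n"
      by (simp_all add: L_def R_def)
    then have "sec_orbit j = (\<Sum>r<n. smult (C r j) ([:-1, 1:] ^ r))"
      unfolding C_def using deg[of j] by (intro poly_eq_sum_shifted_powers) simp
    then have "poly ((sec_op ^^ i) (sec_orbit j)) 1 =
        poly ((sec_op ^^ i) (\<Sum>r<n. smult (C r j) ([:-1, 1:] ^ r))) 1"
      by simp
    also have "\<dots> = (\<Sum>r<n. poly ((sec_op ^^ i) ([:-1, 1:] ^ r)) 1 * C r j)"
      by (simp add: sec_op_pow_sum sec_op_pow_smult poly_sum mult.commute)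
    finally show "mat n n (\<lambda>(i, j). poly ((sec_op ^^ i) (sec_orbit j)) 1) $$ (i, j) = (L * R) $$ (i, j)"
      using ij by (simp add: L_def R_def scalar_prod_def atLeast0LessThan)
  qed (simp_all add: L_def R_def)
  moreover have "det (L * R) = det L * det R"
    by (rule det_mult[of _ n]) (simp_all add: L_def R_def)
  moreover have "det L = (\<Prod>i<n. 2 ^ i * (fact i)^2)"
  proof -
    have "det L = prod_list (diag_mat L)"
      by (rule det_lower_triangular[of n])
        (auto simp: L_def poly_sec_op_pow_shifted_power_eq_0)
    also have "\<dots> = (\<Prod>i<n. 2 ^ i * (fact i)^2)"
      using poly_sec_op_pow_shifted_power_diag[where q = 1]
      by (simp add: diag_mat_def L_def prod.list_conv_set_nth atLeast0LessThan)
    finally show ?thesis .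
  qed
  moreover have "det R = (\<Prod>i<n. (real (double_fact (i - 1)))^2)"
  proof -
    have "det R = prod_list (diag_mat R)"
      by (rule det_upper_triangular[of _ n])
        (auto simp: R_def C_upper)
    also have "\<dots> = (\<Prod>i<n. (real (double_fact (i - 1)))^2)"
      by (simp add: diag_mat_def R_def C_diag prod.list_conv_set_nth atLeast0LessThan)
    finally show ?thesis .
  qed
  ultimately show ?thesis
    by (simp add: prod.distrib)
qed

section \<open>The secant series and the series \<open>U\<^sub>k\<close>\<close>

abbreviation fps_sec :: "real fps" where
  "fps_sec \<equiv> inverse (fps_cos 1)"

lemma fps_sec_mult_cos: "fps_sec * fps_cos 1 = 1"
  by (simp add: inverse_mult_eq_1)

lemma fps_deriv_sec: "fps_deriv fps_sec = fps_sec^2 * fps_sin 1"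
  by (simp add: fps_inverse_deriv fps_cos_deriv mult.commute flip: fps_const_neg)

text \<open>The reflected series \<open>S\<close>, that is \<open>sec (-x)\<close>, also inverts the
  even series \<open>fps_cos 1\<close>, so it equals \<open>fps_sec\<close>.\<close>

lemma fps_sec_odd:
  assumes "odd n"
  shows "fps_nth fps_sec n = 0"
proof -
  define S where "S = Abs_fps (\<lambda>n. (-1) ^ n * fps_nth fps_sec n)"
  have "fps_nth (S * fps_cos 1) n = (-1) ^ n * fps_nth (fps_sec * fps_cos 1) n" for n
    unfolding fps_mult_nth sum_distrib_left
  proof (rule sum.cong)
    fix i assume i: "i \<in> {0..n}"
    show "fps_nth S i * fps_nth (fps_cos 1) (n - i) =
        (-1) ^ n * (fps_nth fps_sec i * fps_nth (fps_cos 1) (n - i))"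
    proof (cases "even (n - i)")
      case True
      then have "(-1 :: real) ^ n = (-1) ^ i"
        using i by (auto simp: minus_one_power_iff)
      then show ?thesis
        by (simp add: S_def)
    qed (simp add: fps_cos_def)
  qed simp
  then have "S * fps_cos 1 = 1"
    by (intro fps_ext) (simp add: fps_sec_mult_cos)
  then have "S * (fps_sec * fps_cos 1) = fps_sec"
    by (metis mult.assoc mult.commute mult.right_neutral)
  then have "S = fps_sec"
    by (simp add: fps_sec_mult_cos)
  then have "fps_nth fps_sec n = (-1) ^ n * fps_nth fps_sec n"
    by (metis S_def fps_nth_Abs_fps)
  then show ?thesis
    using assms by simp
qed

text \<open>
  \<open>sec_integral k\<close> is \<open>U\<^sub>k = sec\<^sup>k x \<integral> cos\<^bsup>k-1\<^esup> x dx\<close>, with the integral taken from \<open>0\<close>; the recursion is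
  the reduction formula for the integral.
\<close>

fun sec_integral :: "nat \<Rightarrow> real fps" where
  "sec_integral 0 = fps_integral0 fps_sec"
| "sec_integral (Suc 0) = fps_X * fps_sec"
| "sec_integral (Suc (Suc k)) = fps_const (1 / (real k + 1)) *
     (fps_const (real k) * fps_sec^2 * sec_integral k + fps_sec^2 * fps_sin 1)"

lemma sec_integral_recurrence:
  "fps_const (real k + 1) * sec_integral (Suc (Suc k)) =
    fps_const (real k) * fps_sec^2 * sec_integral k + fps_sec^2 * fps_sin 1"
  by (simp flip: mult.assoc add: fps_const_mult)

lemma fps_sec_sin_sq: "fps_sec^2 * (fps_sin 1)^2 = fps_sec^2 - 1"
proof -
  define S c s where defs: "S = fps_sec" "c = fps_cos (1::real)" "s = fps_sin (1::real)"
  have "c^2 + s^2 = 1" "S * c = 1"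
    using fps_sec_mult_cos by (simp_all add: defs fps_sin_cos_sum_of_squares)
  then have "S^2 * s^2 = S^2 - 1"
    by Groebner_Basis.algebra \<comment> \<open>qualified because HOL-Algebra has a method of the same name\<close>
  then show ?thesis
    by (simp add: defs)
qed

text \<open>This is the product rule for \<open>sec^k\<close> times the integral, with
  \<open>tan\<close> written as \<open>sec * sin\<close>; the proof derives it from the reduction
  formula.\<close>

lemma sec_integral_deriv:
  "fps_deriv (sec_integral k) = fps_const (real k) * fps_sec * fps_sin 1 * sec_integral k + fps_sec"
proof (induction k rule: sec_integral.induct)
  case 1
  then show ?case by (simp add: fps_deriv_fps_integral)
next
  case 2
  then show ?case by (simp add: fps_deriv_sec power2_eq_square algebra_simps)
next
  case (3 k)
  define K S U V c s where defs: "K = fps_const (real k)" "S = fps_sec" "U = sec_integral k"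
    "V = sec_integral (Suc (Suc k))" "c = fps_cos (1::real)" "s = fps_sin (1::real)"
  have K1: "fps_const (real k + 1) = K + 1" "fps_const (real (Suc (Suc k))) = K + 2"
    by (simp_all add: defs flip: fps_const_add fps_const_1_eq_1 fps_numeral_fps_const)
  have dU: "fps_deriv U = K * S * s * U + S"
    using 3 by (simp add: defs)
  have dS: "fps_deriv S = S^2 * s"
    by (simp add: defs fps_deriv_sec)
  have ds: "fps_deriv s = c"
    by (simp add: defs fps_sin_deriv)
  have rec: "(K + 1) * V = K * S^2 * U + S^2 * s"
    using sec_integral_recurrence[of k] unfolding K1 by (simp add: defs)
  have dK: "fps_deriv K = 0"
    by (simp add: defs)
  \<comment> \<open>Differentiating the recurrence with its denominator cleared leaves a polynomial
    identity; the nonzero factor \<open>K + 1\<close> is cancelled at the end.\<close>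
  have "fps_deriv ((K + 1) * V) = fps_deriv (K * S^2 * U + S^2 * s)"
    by (simp add: rec)
  then have "(K + 1) * fps_deriv V = 2 * K * S * (S^2 * s) * U + K * S^2 * (K * S * s * U + S)
      + 2 * S * (S^2 * s) * s + S^2 * c"
    by (simp add: dU dS ds dK power2_eq_square algebra_simps)
  moreover have "S * c = 1" "S^2 * s^2 = S^2 - 1"
    using fps_sec_mult_cos fps_sec_sin_sq by (simp_all add: defs)
  ultimately have "(K + 1) * fps_deriv V = (K + 1) * ((K + 2) * S * s * V + S)"
    using rec by Groebner_Basis.algebra
  moreover have "K + 1 \<noteq> 0"
    by (simp flip: K1)
  ultimately have "fps_deriv V = (K + 2) * S * s * V + S"
    by simp
  then show ?case
    unfolding K1 by (simp add: defs)
qed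

lemma sec_integral_deriv2:
  "fps_deriv (fps_deriv (sec_integral k)) =
    fps_const ((real k + 1)^2) * sec_integral (k + 2) - fps_const ((real k)^2) * sec_integral k"
proof -
  define K S U V c s where defs: "K = fps_const (real k)" "S = fps_sec" "U = sec_integral k"
    "V = sec_integral (Suc (Suc k))" "c = fps_cos (1::real)" "s = fps_sin (1::real)"
  have K1: "fps_const (real k + 1) = K + 1"
    by (simp add: defs flip: fps_const_add)
  have dU: "fps_deriv U = K * S * s * U + S"
    using sec_integral_deriv[of k] by (simp add: defs)
  have dS: "fps_deriv S = S^2 * s"
    by (simp add: defs fps_deriv_sec)
  have ds: "fps_deriv s = c"
    by (simp add: defs fps_sin_deriv)
  have dK: "fps_deriv K = 0"
    by (simp add: defs)
  have "fps_deriv (fps_deriv U) =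
      K * (S^2 * s) * s * U + K * S * c * U + K * S * s * (K * S * s * U + S) + S^2 * s"
    unfolding dU by (simp add: dU dS ds dK algebra_simps)
  moreover have "(K + 1) * V = K * S^2 * U + S^2 * s"
    using sec_integral_recurrence[of k] unfolding K1 by (simp add: defs)
  moreover have "S * c = 1" "S^2 * s^2 = S^2 - 1"
    using fps_sec_mult_cos fps_sec_sin_sq by (simp_all add: defs)
  ultimately have "fps_deriv (fps_deriv U) = (K + 1)^2 * V - K^2 * U"
    by Groebner_Basis.algebra
  then show ?thesis
    unfolding K1[symmetric] by (simp add: defs power2_eq_square)
qed

text \<open>Matches the value of \<open>v^k\<close> at 1, the base case of the transfer from series
  to polynomials.\<close>

lemma sec_integral_nth_1: "fps_nth (sec_integral k) 1 = 1"
proof -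
  have "fps_nth (sec_integral k) 0 = 0"
    by (induction k rule: sec_integral.induct) simp_all
  moreover have "fps_nth (fps_deriv (sec_integral k)) 0 = fps_nth (sec_integral k) 1"
    by simp
  ultimately show ?thesis
    unfolding sec_integral_deriv by simp
qed

lemma poly_sec_op_pow_monom:
  "poly ((sec_op ^^ i) (monom 1 k)) 1 = fact (2 * i + 1) * fps_nth (sec_integral k) (2 * i + 1)"
proof (induction i arbitrary: k)
  case 0
  then show ?case
    using sec_integral_nth_1[of k] by (simp add: poly_monom)
next
  case (Suc i)
  have "poly ((sec_op ^^ Suc i) (monom 1 k)) 1 =
      (real k + 1)^2 * poly ((sec_op ^^ i) (monom 1 (k + 2))) 1 -
      (real k)^2 * poly ((sec_op ^^ i) (monom 1 k)) 1"
    by (simp only: funpow_Suc_right o_apply sec_op_monom sec_op_pow_add sec_op_pow_smult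
        poly_add poly_smult)
  also have "\<dots> = fact (2 * i + 1) * fps_nth (fps_deriv (fps_deriv (sec_integral k))) (2 * i + 1)"
    unfolding sec_integral_deriv2 Suc.IH
    by (simp only: fps_sub_nth fps_mult_left_const_nth right_diff_distrib mult.left_commute)
  also have "\<dots> = fact (2 * Suc i + 1) * fps_nth (sec_integral k) (2 * Suc i + 1)"
    by (simp add: algebra_simps)
  finally show ?case .
qed

section \<open>The coefficients of \<open>f\<close> as values of polynomials at 1\<close>

lemma egf_coeff_even:
  "egf_coeff ((1 + fps_X) / fps_cos 1) (2 * k) = secant_number (2 * k)"
  by (cases k)
    (simp_all add: egf_coeff_def secant_number_def fps_divide_unit distrib_right fps_sec_odd)

lemma egf_coeff_odd:
  "egf_coeff ((1 + fps_X) / fps_cos 1) (2 * k + 1) = real (2 * k + 1) * secant_number (2 * k)"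
  by (simp add: egf_coeff_def secant_number_def fps_divide_unit distrib_right fps_sec_odd)

lemma egf_coeff_eq_sec_op:
  "egf_coeff ((1 + fps_X) / fps_cos 1) (2 * i + j) = poly ((sec_op ^^ i) (sec_orbit j)) 1"
proof -
  \<comment> \<open>Both the index \<open>2 * i + j\<close> and the iterated operator depend only on
    \<open>m\<close> and the parity of \<open>j\<close>.\<close>
  define m where "m = i + j div 2"
  have orbit: "(sec_op ^^ i) (sec_orbit j) = (sec_op ^^ m) (monom 1 (j mod 2))"
    by (simp add: sec_orbit_def m_def funpow_add)
  have idx: "2 * i + j = 2 * m + j mod 2"
    by (simp add: m_def)
  consider "j mod 2 = 0" | "j mod 2 = 1"
    by linarith
  then show ?thesis
  proof cases
    case 1
    then have "egf_coeff ((1 + fps_X) / fps_cos 1) (2 * i + j) = fact (2 * m) * fps_nth fps_sec (2 * m)"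
      unfolding idx
      by (simp only: add_0_right egf_coeff_even) (simp add: secant_number_def egf_coeff_def fps_divide_unit)
    then show ?thesis
      unfolding orbit using 1
      by (simp only: poly_sec_op_pow_monom) (simp add: fps_integral_def)
  next
    case 2
    then have "egf_coeff ((1 + fps_X) / fps_cos 1) (2 * i + j) =
        real (2 * m + 1) * (fact (2 * m) * fps_nth fps_sec (2 * m))"
      unfolding idx
      by (simp only: egf_coeff_odd) (simp add: secant_number_def egf_coeff_def fps_divide_unit)
    then show ?thesis
      unfolding orbit using 2
      by (simp only: poly_sec_op_pow_monom) simp
  qed
qed

section \<open>Evaluation of the product\<close>

lemma fact_eq_double_fact: "fact m = double_fact m * double_fact (m - 1)"
proof (induction m)
  case (Suc m)
  then show ?case
    by (simp add: double_fact_step mult.assoc mult.left_commute del: mult_Suc)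
qed simp

text \<open>The new factor contains \<open>(m+1)!^2 (m!!)^2 = ((m+1)!!)^2 (m!!)^4\<close>; with the
  earlier \<open>(m!!)^2\<close> this makes the sixth power.\<close>

lemma prod_fact_double_fact:
  "(\<Prod>i<Suc m. 2 ^ i * (fact i)^2 * (real (double_fact (i - 1)))^2) =
    2 ^ (Suc m choose 2) * (real (double_fact m))^2 * (\<Prod>k = 1..m - 1. (real (double_fact k)) ^ 6)"
proof (induction m)
  case (Suc m)
  have fact: "fact (Suc m) = real (double_fact (Suc m)) * real (double_fact m)"
    using fact_eq_double_fact[of "Suc m"] by (metis diff_Suc_1 of_nat_fact of_nat_mult)
  \<comment> \<open>For \<open>m = 0\<close> both ranges are empty and the extra factor is
    \<open>0!!^6 = 1\<close>.\<close>
  have prod: "(\<Prod>k = 1..m. (real (double_fact k)) ^ 6) =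
      (\<Prod>k = 1..m - 1. (real (double_fact k)) ^ 6) * real (double_fact m) ^ 6"
    by (cases m) simp_all
  have choose: "Suc (Suc m) choose 2 = (Suc m choose 2) + Suc m"
    by (simp add: numeral_2_eq_2)
  show ?case
    unfolding prod.lessThan_Suc[of _ "Suc m"] Suc.IH fact choose diff_Suc_1 prod
    by (simp only: power_add power_mult_distrib) (simp add: algebra_simps eval_nat_numeral)
qed (simp add: numeral_2_eq_2)

theorem proposition11p1:
  fixes f :: "real fps"
  assumes f: "f = (1 + fps_X) / fps_cos 1"
  shows "(\<forall>k. egf_coeff f (2 * k) = secant_number (2 * k)) \<and>
    (\<forall>k. egf_coeff f (2 * k + 1) = real (2 * k + 1) * secant_number (2 * k)) \<and>
    (\<forall>n\<ge>1. ddot_hankel n f =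
      2 ^ (n choose 2) * (real (double_fact (n - 1)))^2 *
      (\<Prod>k = 1..n - 2. (real (double_fact k)) ^ 6))"
proof (intro conjI allI impI)
  fix n :: nat
  assume "n \<ge> 1"
  then obtain m where n: "n = Suc m"
    by (cases n) auto
  have "ddot_hankel n f = (\<Prod>i<n. 2 ^ i * (fact i)^2 * (real (double_fact (i - 1)))^2)"
    unfolding ddot_hankel_def f egf_coeff_eq_sec_op by (rule det_sec_op)
  then show "ddot_hankel n f = 2 ^ (n choose 2) * (real (double_fact (n - 1)))^2 *
      (\<Prod>k = 1..n - 2. (real (double_fact k)) ^ 6)"
    using prod_fact_double_fact[of m] by (simp add: n numeral_2_eq_2)
qed (simp_all only: f egf_coeff_even egf_coeff_odd)

end
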